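(* There is a universal constant $C>0$ such that the following holds. Let $\theta:\mathbb{R}\to\mathbb{R}$ be even, continuous, non-negative, and monotone decreasing in $[0,+\infty)$. Let $A\ge0$ and assume $\Lambda\theta\ge-A$ on $\mathbb{R}$. Then $$\theta(x_1)-\theta(x_2)\le C\max\left(\|\theta\|_{L^\infty},\,A\,x_1\right)\left(\frac{x_2-x_1}{x_1}\right)^{1/2}$$ for all $0<x_1<x_2$.
   Context: $\Lambda=(-\Delta)^{1/2}$ on $\mathbb{R}$, i.e. $\Lambda\theta(x)=\frac1\pi\,\mathrm{p.v.}\int_{\mathbb{R}}\frac{\theta(x)-\theta(y)}{(x-y)^2}\,dy$. *)

theory Defs
  imports "HOL-Analysis.Analysis" "HOL-Probability.Essential_Supremum"
begin

text \<open>
  \<open>has_half_laplacian f x L\<close>: the principal value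
  \<open>1/\<pi> p.v. \<integral> (f x - f y) / (x - y)\<^sup>2 dy\<close>, i.e. the limit of the integrals over \<open>\<bar>x - y\<bar> > e\<close>
  as \<open>e\<close> tends to 0 from above, exists in the extended reals and equals \<open>L\<close>.
  An infinite \<open>L\<close> can only come from the limit, not from the truncated integrals, which are
  required to converge absolutely (automatic for bounded continuous \<open>f\<close>).
\<close>

definition half_laplacian_kernel :: "(real \<Rightarrow> real) \<Rightarrow> real \<Rightarrow> real \<Rightarrow> real" where
  "half_laplacian_kernel f x y = (f x - f y) / (x - y)\<^sup>2"

definition has_half_laplacian :: "(real \<Rightarrow> real) \<Rightarrow> real \<Rightarrow> ereal \<Rightarrow> bool" where
  "has_half_laplacian f x L \<longleftrightarrow>
     (\<forall>e>0. set_integrable lborel {y. e < \<bar>x - y\<bar>} (half_laplacian_kernel f x)) \<and>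
     ((\<lambda>e. ereal (1 / pi * (LINT y:{y. e < \<bar>x - y\<bar>}|lborel. half_laplacian_kernel f x y)))
        \<longlongrightarrow> L) (at_right 0)"

text \<open>
  The \<open>L\<^sup>\<infinity>\<close> norm on the real line. The conversion to \<open>real\<close> sends \<open>\<infinity>\<close> to 0, so the value is only
  meaningful for essentially bounded \<open>f\<close>. An even, non-negative function that is decreasing on
  \<open>{0..}\<close> is bounded by its value at 0.
\<close>

definition Linfty_norm :: "(real \<Rightarrow> real) \<Rightarrow> real" where
  "Linfty_norm f = real_of_ereal (esssup lborel (\<lambda>x. ereal \<bar>f x\<bar>))"

end

theory Submission
  imports Defs "HOL-Real_Asymp.Real_Asymp"
begin

text \<open>
  A barrier argument. Let \<open>m = \<theta> a\<close> with \<open>a = x\<^sub>1\<close>, let \<open>M\<close> be the maximum in the claim,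
  \<open>K = 4 M / sqrt a\<close> and \<open>R = m / K\<close>. The barrier \<open>\<phi>\<close> equals \<open>m\<close> on \<open>{- a..a}\<close>,
  \<open>m - K sqrt (y - a)\<close> on \<open>{a..a + R\<^sup>2}\<close> and 0 elsewhere, so that \<open>\<phi> \<le> \<theta>\<close> outside
  \<open>{a..a + R\<^sup>2}\<close> by evenness and monotonicity. If \<open>\<theta> < \<phi>\<close> somewhere, then \<open>\<theta> - \<phi>\<close> has a negative
  minimum at some \<open>x\<^sub>0\<close> strictly inside this interval, and \<open>\<Lambda>\<theta>(x\<^sub>0) \<le> \<Lambda>\<phi>(x\<^sub>0)\<close>. The square root of
  the positive part is \<open>\<Lambda>\<close>-harmonic on the positive half-line. Hence only the truncations of the
  profile contribute to \<open>\<Lambda>\<phi>(x\<^sub>0)\<close>: at most \<open>K R / (2 a)\<close> on the far left, at most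
  \<open>- K / (2 R)\<close> on the far right, both divided by \<open>\<pi>\<close>. With \<open>m \<le> M\<close> and \<open>A a \<le> M\<close> the sum is
  below \<open>- A\<close>.
\<close>

section \<open>Integrals of the inverse square kernel away from its pole\<close>

lemma has_integral_inverse_square_atLeast:
  fixes x b :: real
  assumes "x < b"
  shows "((\<lambda>y. 1 / (x - y)\<^sup>2) has_integral 1 / (b - x)) {b..}"
proof -
  have deriv: "((\<lambda>y. 1 / (x - y)) has_real_derivative 1 / (x - y)\<^sup>2) (at y)"
    and cont: "isCont (\<lambda>y. 1 / (x - y)\<^sup>2) y" if "ereal b < ereal y" "ereal y < \<infinity>" for y
    using that assms by (auto intro!: derivative_eq_intros simp: power2_eq_square)
  have lim1: "(((\<lambda>y. 1 / (x - y)) \<circ> real_of_ereal) \<longlongrightarrow> 1 / (x - b)) (at_right (ereal b))"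
    unfolding ereal_tendsto_simps using assms by (auto intro!: tendsto_eq_intros)
  have lim2: "(((\<lambda>y. 1 / (x - y)) \<circ> real_of_ereal) \<longlongrightarrow> 0) (at_left (\<infinity>))"
    unfolding ereal_tendsto_simps by real_asymp
  \<comment> \<open>The version for nonnegative integrands yields integrability on the unbounded
    interval together with the value.\<close>
  note FTC = interval_integral_FTC_nonneg[OF _ deriv cont _ lim1 lim2, simplified]
  have "((\<lambda>y. 1 / (x - y)\<^sup>2) has_integral 1 / (b - x)) {b<..}"
    using set_borel_integral_eq_integral[OF FTC(1)] FTC(2) assms
    by (simp add: interval_lebesgue_integral_def has_integral_iff minus_divide_right)
  then show ?thesis
    by (rule iffD1[OF has_integral_spike_set_eq, rotated 2])
      (rule negligible_subset[of "{b}"]; force)+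
qed

lemma has_integral_inverse_square_atMost:
  fixes x b :: real
  assumes "b < x"
  shows "((\<lambda>y. 1 / (x - y)\<^sup>2) has_integral 1 / (x - b)) {..b}"
proof -
  have deriv: "((\<lambda>y. 1 / (x - y)) has_real_derivative 1 / (x - y)\<^sup>2) (at y)"
    and cont: "isCont (\<lambda>y. 1 / (x - y)\<^sup>2) y" if "-\<infinity> < ereal y" "ereal y < ereal b" for y
    using that assms by (auto intro!: derivative_eq_intros simp: power2_eq_square)
  have lim1: "(((\<lambda>y. 1 / (x - y)) \<circ> real_of_ereal) \<longlongrightarrow> 0) (at_right (-\<infinity>))"
    unfolding ereal_tendsto_simps by real_asymp
  have lim2: "(((\<lambda>y. 1 / (x - y)) \<circ> real_of_ereal) \<longlongrightarrow> 1 / (x - b)) (at_left (ereal b))"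
    unfolding ereal_tendsto_simps using assms by (auto intro!: tendsto_eq_intros)
  note FTC = interval_integral_FTC_nonneg[OF _ deriv cont _ lim1 lim2, simplified]
  have "((\<lambda>y. 1 / (x - y)\<^sup>2) has_integral 1 / (x - b)) {..<b}"
    using set_borel_integral_eq_integral[OF FTC(1)] FTC(2) assms
    by (simp add: interval_lebesgue_integral_def has_integral_iff minus_divide_right)
  then show ?thesis
    by (rule iffD1[OF has_integral_spike_set_eq, rotated 2])
      (rule negligible_subset[of "{b}"]; force)+
qed

lemma has_integral_inverse_square_interval:
  fixes x b c :: real
  assumes "b \<le> c" "c < x"
  shows "((\<lambda>y. 1 / (x - y)\<^sup>2) has_integral (1 / (x - c) - 1 / (x - b))) {b..c}"
  using assms
  by (intro fundamental_theorem_of_calculus)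
    (auto intro!: derivative_eq_intros simp: power2_eq_square
       simp flip: has_real_derivative_iff_has_vector_derivative)

section \<open>The square root profile integrated against the kernel\<close>

text \<open>
  Found by substituting \<open>s = sqrt (y - a)\<close> in \<open>(sqrt (y - a) - t) / (a + t\<^sup>2 - y)\<^sup>2\<close>; the part that is
  singular at \<open>a + t\<^sup>2\<close> is even around that point, so it cancels in the principal value.
\<close>

definition sqrt_primitive :: "real \<Rightarrow> real \<Rightarrow> real \<Rightarrow> real" where
  "sqrt_primitive a t y = ln ((a + t\<^sup>2 - y)\<^sup>2) / (4 * t)
     - (ln (sqrt (y - a) + t) / t + 1 / (sqrt (y - a) + t))"

lemma has_field_derivative_sqrt_primitive:
  assumes "0 < t" "a < y" "y \<noteq> a + t\<^sup>2"
  shows "(sqrt_primitive a t has_field_derivative (sqrt (y - a) - t) / (a + t\<^sup>2 - y)\<^sup>2) (at y)"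
proof -
  define s where "s = sqrt (y - a)"
  have s: "s > 0" "y = a + s\<^sup>2" "s + t > 0"
    using assms by (auto simp: s_def add_pos_pos)
  have "s \<noteq> t" using assms s by auto
  have fac: "t\<^sup>2 - s\<^sup>2 = - ((s - t) * (s + t))" by (simp add: algebra_simps power2_eq_square)
  \<comment> \<open>The left side has the shape that the differentiation rules produce below. In
    terms of \<open>s\<close> the claim is a rational identity, and \<open>fac\<close> exposes the
    common factors.\<close>
  have id: "2 * (t\<^sup>2 - s\<^sup>2) * (-1) / (t\<^sup>2 - s\<^sup>2)\<^sup>2 / (4 * t)
      - (1 / (2 * s) / (s + t) / t + - (1 / (2 * s) / (s + t)\<^sup>2)) = (s - t) / (t\<^sup>2 - s\<^sup>2)\<^sup>2"
    unfolding fac using s(1,3) \<open>s \<noteq> t\<close> assms(1)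
    by (simp add: divide_simps) (simp add: algebra_simps power2_eq_square)
  have "((\<lambda>y. ln ((a + t\<^sup>2 - y)\<^sup>2)) has_field_derivative
      2 * (t\<^sup>2 - s\<^sup>2) * (-1) / (t\<^sup>2 - s\<^sup>2)\<^sup>2) (at y)"
    using assms s by (auto intro!: derivative_eq_intros)
  moreover have root: "((\<lambda>y. sqrt (y - a) + t) has_field_derivative 1 / (2 * s)) (at y)"
    using assms by (auto intro!: derivative_eq_intros simp: s_def divide_simps)
  have "((\<lambda>y. ln (sqrt (y - a) + t)) has_field_derivative 1 / (2 * s) / (s + t)) (at y)"
    by (rule DERIV_cong[OF DERIV_chain2[where f = ln, OF DERIV_ln root]])
      (use s(1,3) in \<open>simp_all add: s_def[symmetric] divide_simps\<close>)
  moreover have "((\<lambda>y. 1 / (sqrt (y - a) + t)) has_field_derivative - (1 / (2 * s) / (s + t)\<^sup>2)) (at y)"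
    using DERIV_inverse_fun[OF root] s by (simp add: s_def[symmetric] field_simps power2_eq_square)
  ultimately have "(sqrt_primitive a t has_field_derivative
      2 * (t\<^sup>2 - s\<^sup>2) * (-1) / (t\<^sup>2 - s\<^sup>2)\<^sup>2 / (4 * t)
      - (1 / (2 * s) / (s + t) / t + - (1 / (2 * s) / (s + t)\<^sup>2))) (at y)"
    unfolding sqrt_primitive_def[abs_def] by (intro DERIV_diff DERIV_add DERIV_cdivide)
  then show ?thesis
    unfolding id by (simp add: s(2) abs_of_pos[OF s(1)])
qed

text \<open>The derivative above is only available for \<open>y > a\<close>. Continuity up to
  \<open>a\<close> itself lets the fundamental theorem start at the branch point.\<close>

lemma continuous_on_sqrt_primitive:
  assumes "0 < t" "a + t\<^sup>2 \<notin> S" "S \<subseteq> {a..}"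
  shows "continuous_on S (sqrt_primitive a t)"
  unfolding sqrt_primitive_def[abs_def] using assms
  by (intro continuous_intros) (auto simp: add_nonneg_pos less_imp_neq[symmetric] subset_iff)

lemma has_integral_sqrt_primitive:
  assumes "0 < t" "a \<le> b" "b \<le> c" "a + t\<^sup>2 \<notin> {b..c}"
  shows "((\<lambda>y. (sqrt (y - a) - t) / (a + t\<^sup>2 - y)\<^sup>2) has_integral
           (sqrt_primitive a t c - sqrt_primitive a t b)) {b..c}"
  using assms
  by (intro fundamental_theorem_of_calculus_interior continuous_on_sqrt_primitive)
    (auto simp flip: has_real_derivative_iff_has_vector_derivative
      intro!: has_field_derivative_sqrt_primitive)

section \<open>Comparison with the barrier under the truncated integral\<close>

text \<open>The last three hypotheses bound \<open>f x - f y\<close> by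
  \<open>\<phi> x - \<phi> y\<close> for the barrier of height \<open>K * R\<close>. Each piece of
  the barrier is integrated exactly; \<open>t\<close> is the square root of the distance from
  \<open>x\<close> to \<open>a\<close>.\<close>

lemma truncated_half_laplacian_le:
  fixes a t R K e :: real and f :: "real \<Rightarrow> real"
  defines "x \<equiv> a + t\<^sup>2"
  assumes pos: "0 < a" "0 < t" "t < R" and e: "0 < e" "e < t\<^sup>2" "e < R\<^sup>2 - t\<^sup>2"
    and int: "set_integrable lborel {y. e < \<bar>x - y\<bar>} (half_laplacian_kernel f x)"
    and far: "\<And>y. y \<le> - a \<or> a + R\<^sup>2 \<le> y \<Longrightarrow> f x - f y \<le> K * (R - t)"
    and mid: "\<And>y. \<bar>y\<bar> \<le> a \<Longrightarrow> f x - f y \<le> - K * t"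
    and near: "\<And>y. a \<le> y \<Longrightarrow> y \<le> a + R\<^sup>2 \<Longrightarrow> f x - f y \<le> K * (sqrt (y - a) - t)"
  shows "(LINT y:{y. e < \<bar>x - y\<bar>}|lborel. half_laplacian_kernel f x y)
    \<le> K * (R / (x + a) - 1 / t + 1 / (R + t)
        + (sqrt_primitive a t (x - e) - sqrt_primitive a t a)
        + (sqrt_primitive a t (a + R\<^sup>2) - sqrt_primitive a t (x + e)))"
proof -
  let ?k = "half_laplacian_kernel f x"
  let ?P = "sqrt_primitive a t"
  have xa: "x - a = t\<^sup>2" by (simp add: x_def)
  have sub: "(?k has_integral integral S ?k) S"
    if "S \<subseteq> {y. e < \<bar>x - y\<bar>}" "S \<in> sets lborel" for S
    using set_borel_integral_eq_integral(1)[OF set_integrable_subset[OF int that(2,1)]]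
    by (rule integrable_integral)
  have bound: "integral S ?k \<le> c"
    if "((\<lambda>y. h y / (x - y)\<^sup>2) has_integral c) S" "(?k has_integral integral S ?k) S"
      "\<And>y. y \<in> S \<Longrightarrow> f x - f y \<le> h y" for S c h
    using that(2,1) by (rule has_integral_le) (simp add: half_laplacian_kernel_def divide_right_mono that(3))
  have const: "((\<lambda>y. c / (x - y)\<^sup>2) has_integral c * I) S"
    if "((\<lambda>y. 1 / (x - y)\<^sup>2) has_integral I) S" for c I S
    using has_integral_mult_right[OF that, of c] by simp
  \<comment> \<open>Neighbouring pieces share only \<open>- a\<close>, \<open>a\<close> or
    \<open>a + R\<^sup>2\<close>, so the integrals add. The open ends at \<open>x - e\<close> and
    \<open>x + e\<close> make the union exactly the truncated domain.\<close>
  define S1 S2 S3 S4 S5 where S: "S1 = {..- a}" "S2 = {- a..a}" "S3 = {a..<x - e}"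
    "S4 = {x + e<..a + R\<^sup>2}" "S5 = {a + R\<^sup>2..}"
  have R: "R\<^sup>2 - t\<^sup>2 = (R - t) * (R + t)"
    by (simp add: algebra_simps power2_eq_square)
  have k: "(?k has_integral integral S1 ?k) S1" "(?k has_integral integral S2 ?k) S2"
    "(?k has_integral integral S3 ?k) S3" "(?k has_integral integral S4 ?k) S4"
    "(?k has_integral integral S5 ?k) S5"
    by (rule sub; use pos e in \<open>auto simp: S x_def\<close>)+
  have "(?k has_integral integral S1 ?k + integral S2 ?k + integral S3 ?k
      + integral S4 ?k + integral S5 ?k) (S1 \<union> S2 \<union> S3 \<union> S4 \<union> S5)"
    by (intro has_integral_Un k)
      (use pos e in \<open>auto simp: S x_def intro: negligible_subset[of "{- a, a, a + R\<^sup>2}"]\<close>)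
  moreover have "S1 \<union> S2 \<union> S3 \<union> S4 \<union> S5 = {y. e < \<bar>x - y\<bar>}"
    using pos e by (auto simp: S x_def)
  ultimately have "integral {y. e < \<bar>x - y\<bar>} ?k
      = integral S1 ?k + integral S2 ?k + integral S3 ?k + integral S4 ?k + integral S5 ?k"
    by (simp add: integral_unique)
  moreover have "integral S1 ?k \<le> K * (R - t) * (1 / (x + a))"
    using pos far has_integral_inverse_square_atMost[of "- a" x]
    by (intro bound[OF const k(1)]) (auto simp: S x_def add_pos_pos)
  moreover have "integral S2 ?k \<le> - K * t * (1 / t\<^sup>2 - 1 / (x + a))"
    using pos mid has_integral_inverse_square_interval[of "- a" a x] xa
    by (intro bound[OF const k(2)]) (auto simp: S x_def)
  moreover have "integral S3 ?k \<le> K * (?P (x - e) - ?P a)"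
  proof (rule bound[OF _ k(3)])
    have "((\<lambda>y. (sqrt (y - a) - t) / (x - y)\<^sup>2) has_integral (?P (x - e) - ?P a)) {a..x - e}"
      unfolding x_def by (rule has_integral_sqrt_primitive) (use pos e in auto)
    then have "((\<lambda>y. (sqrt (y - a) - t) / (x - y)\<^sup>2) has_integral (?P (x - e) - ?P a)) S3"
      by (rule iffD1[OF has_integral_spike_set_eq, rotated 2])
      (rule negligible_subset[of "{x - e}"]; force simp: S)+
    from has_integral_mult_right[OF this, of K]
    show "((\<lambda>y. K * (sqrt (y - a) - t) / (x - y)\<^sup>2) has_integral K * (?P (x - e) - ?P a)) S3"
      by simp
  qed (use near pos e in \<open>auto simp: S x_def\<close>)
  moreover have "integral S4 ?k \<le> K * (?P (a + R\<^sup>2) - ?P (x + e))"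
  proof (rule bound[OF _ k(4)])
    have "((\<lambda>y. (sqrt (y - a) - t) / (x - y)\<^sup>2) has_integral (?P (a + R\<^sup>2) - ?P (x + e))) {x + e..a + R\<^sup>2}"
      unfolding x_def by (rule has_integral_sqrt_primitive) (use pos e in auto)
    then have "((\<lambda>y. (sqrt (y - a) - t) / (x - y)\<^sup>2) has_integral (?P (a + R\<^sup>2) - ?P (x + e))) S4"
      by (rule iffD1[OF has_integral_spike_set_eq, rotated 2])
      (rule negligible_subset[of "{x + e}"]; force simp: S)+
    from has_integral_mult_right[OF this, of K]
    show "((\<lambda>y. K * (sqrt (y - a) - t) / (x - y)\<^sup>2) has_integral K * (?P (a + R\<^sup>2) - ?P (x + e))) S4"
      by simp
  qed (use near pos e in \<open>auto simp: S x_def\<close>)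
  moreover have "integral S5 ?k \<le> K * (R - t) * (1 / (R\<^sup>2 - t\<^sup>2))"
    using pos e far has_integral_inverse_square_atLeast[of x "a + R\<^sup>2"]
    by (intro bound[OF const k(5)]) (auto simp: S x_def)
  moreover have "K * (R - t) * (1 / (R\<^sup>2 - t\<^sup>2)) = K * (1 / (R + t))"
    unfolding R using pos by simp
  moreover have "- K * t * (1 / t\<^sup>2 - 1 / (x + a)) = K * (t / (x + a) - 1 / t)"
    using pos by (simp add: power2_eq_square algebra_simps)
  \<comment> \<open>Far left and plateau together: the terms with \<open>t / (x + a)\<close>
    cancel.\<close>
  moreover have "K * (R - t) * (1 / (x + a)) + K * (t / (x + a) - 1 / t) = K * (R / (x + a) - 1 / t)"
    by (simp add: algebra_simps diff_divide_distrib)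
  ultimately show ?thesis
    using set_borel_integral_eq_integral(2)[OF int] by (simp only: distrib_left)
qed

lemma sqrt_primitive_limit:
  assumes "0 < t"
  shows "((\<lambda>e. sqrt_primitive a t (a + t\<^sup>2 - e) - sqrt_primitive a t (a + t\<^sup>2 + e)) \<longlongrightarrow> 0) (at_right 0)"
proof -
  \<comment> \<open>\<open>?H\<close> is the part of the primitive that is regular at the pole. The
    logarithms depend only on \<open>e\<^sup>2\<close> and cancel for every
    \<open>e\<close>.\<close>
  let ?H = "\<lambda>y. ln (sqrt (y - a) + t) / t + 1 / (sqrt (y - a) + t)"
  have "((\<lambda>e. ?H (a + t\<^sup>2 + e) - ?H (a + t\<^sup>2 - e)) \<longlongrightarrow> ?H (a + t\<^sup>2 + 0) - ?H (a + t\<^sup>2 - 0)) (at_right 0)"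
    by (intro tendsto_intros) (use assms in auto)
  then show ?thesis
    by (simp add: sqrt_primitive_def diff_diff_eq add.commute)
qed

text \<open>The bound \<open>ln r \<le> r - 1\<close> at \<open>r = (R - t) / (R + t)\<close> turns
  the logarithmic term into \<open>- 1 / (R + t)\<close>. The term \<open>1 / t\<close>, the limit
  for large \<open>R\<close>, is what a plateau continued to minus infinity cancels: the harmonicity
  of the profile.\<close>

lemma sqrt_primitive_difference_le:
  assumes "0 < t" "t < R"
  shows "sqrt_primitive a t (a + R\<^sup>2) - sqrt_primitive a t a \<le> 1 / t - 2 / (R + t)"
proof -
  have "(t\<^sup>2 - R\<^sup>2)\<^sup>2 = (R - t)\<^sup>2 * (R + t)\<^sup>2"
    by (simp add: algebra_simps power2_eq_square)
  then have 1: "ln ((t\<^sup>2 - R\<^sup>2)\<^sup>2) = 2 * ln (R - t) + 2 * ln (R + t)"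
    using assms by (simp add: ln_mult ln_realpow)
  have "ln ((R - t) / (R + t)) \<le> (R - t) / (R + t) - 1"
    using assms by (intro ln_le_minus_one) simp
  then have 3: "ln (R - t) - ln (R + t) \<le> - 2 * t / (R + t)"
    using assms by (simp add: ln_div diff_divide_eq_iff) (simp add: field_simps)
  have Pa: "sqrt_primitive a t a = - (1 / t)"
    using assms by (simp add: sqrt_primitive_def ln_realpow)
  have "(2 * A + 2 * B) / (4 * t) - B / t = (A - B) / (2 * t)" for A B :: real
    using assms by (simp add: field_simps)
  from this[of "ln (R - t)" "ln (R + t)"]
  have PR: "sqrt_primitive a t (a + R\<^sup>2) = (ln (R - t) - ln (R + t)) / (2 * t) - 1 / (R + t)"
    using assms by (simp add: sqrt_primitive_def 1 diff_diff_eq[symmetric])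
  have "sqrt_primitive a t (a + R\<^sup>2) - sqrt_primitive a t a
      = (ln (R - t) - ln (R + t)) / (2 * t) + (1 / t - 1 / (R + t))"
    unfolding Pa PR by simp
  also have "\<dots> \<le> (- 2 * t / (R + t)) / (2 * t) + (1 / t - 1 / (R + t))"
    by (intro add_right_mono divide_right_mono 3) (use assms in simp)
  also have "\<dots> = - (1 / (R + t)) + (1 / t - 1 / (R + t))"
    using assms by simp
  also have "\<dots> = 1 / t - 2 / (R + t)"
    using add_divide_distrib[of 1 1 "R + t"] by simp
  finally show ?thesis .
qed

section \<open>Pointwise values and the essential supremum\<close>

text \<open>By continuity, the set where the norm is exceeded is open; it is also null, hence
  empty.\<close>

lemma abs_le_Linfty_norm:
  assumes "continuous_on UNIV f" "\<And>x. \<bar>f x\<bar> \<le> B"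
  shows "\<bar>f a\<bar> \<le> Linfty_norm f"
proof (rule ccontr)
  let ?E = "esssup lborel (\<lambda>x. ereal \<bar>f x\<bar>)"
  assume a: "\<not> \<bar>f a\<bar> \<le> Linfty_norm f"
  have [measurable]: "f \<in> borel_measurable borel"
    using assms(1) by (rule borel_measurable_continuous_onI)
  have AE: "AE x in lborel. ereal \<bar>f x\<bar> \<le> ?E"
    by (rule esssup_AE)
  have "?E \<le> ereal B"
    using assms(2) by (intro esssup_I) auto
  moreover have "?E \<ge> 0"
  proof (rule ccontr)
    assume neg: "\<not> ?E \<ge> 0"
    have "AE x::real in lborel. False"
      by (rule eventually_mono[OF AE]) (use neg in \<open>meson abs_ge_zero ereal_less_eq(5) order_trans\<close>)
    then show False
      by (simp add: eventually_False ae_filter_eq_bot_iff)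
  qed
  \<comment> \<open>Lying between 0 and \<open>B\<close>, the essential supremum is finite, so
    \<open>real_of_ereal\<close> does not fall back to its default 0.\<close>
  ultimately have E: "?E = ereal (Linfty_norm f)"
    by (cases ?E) (auto simp: Linfty_norm_def)
  define U where "U = {x. Linfty_norm f < \<bar>f x\<bar>}"
  have "open U"
    unfolding U_def by (intro open_Collect_less continuous_intros assms)
  have "AE x in lborel. x \<notin> U"
    using AE by (simp add: E U_def not_less)
  then have "U \<in> null_sets lborel"
    using \<open>open U\<close> by (subst AE_iff_null_sets) auto
  then have "negligible U"
    by (simp add: negligible_iff_null_sets null_sets_completionI)
  then have "U = {}"
    using open_not_negligible[OF \<open>open U\<close>] by blast
  with a show False
    by (auto simp: U_def not_le)
qed

section \<open>The principal value at the touching point\<close>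

lemma half_laplacian_barrier_le:
  fixes a t R K :: real and f :: "real \<Rightarrow> real"
  assumes pos: "0 < a" "0 < t" "t < R" "0 \<le> K"
    and lap: "has_half_laplacian f (a + t\<^sup>2) L"
    and bounds:
      "\<And>y. y \<le> - a \<or> a + R\<^sup>2 \<le> y \<Longrightarrow> f (a + t\<^sup>2) - f y \<le> K * (R - t)"
      "\<And>y. \<bar>y\<bar> \<le> a \<Longrightarrow> f (a + t\<^sup>2) - f y \<le> - K * t"
      "\<And>y. a \<le> y \<Longrightarrow> y \<le> a + R\<^sup>2 \<Longrightarrow> f (a + t\<^sup>2) - f y \<le> K * (sqrt (y - a) - t)"
  shows "L \<le> ereal (1 / pi * (K * (R / (2 * a) - 1 / (2 * R))))"
proof -
  let ?P = "sqrt_primitive a t"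
  define c where "c = R / (a + t\<^sup>2 + a) - 1 / t + 1 / (R + t)"
  define B where "B = (\<lambda>e. K * (c + (?P (a + t\<^sup>2 - e) - ?P a) + (?P (a + R\<^sup>2) - ?P (a + t\<^sup>2 + e))))"
  have int: "set_integrable lborel {y. e < \<bar>a + t\<^sup>2 - y\<bar>} (half_laplacian_kernel f (a + t\<^sup>2))"
    if "e > 0" for e
    using lap that by (auto simp: has_half_laplacian_def)
  have lim: "((\<lambda>e. ereal (1 / pi * (LINT y:{y. e < \<bar>a + t\<^sup>2 - y\<bar>}|lborel.
      half_laplacian_kernel f (a + t\<^sup>2) y))) \<longlongrightarrow> L) (at_right 0)"
    using lap by (auto simp: has_half_laplacian_def)
  have "t\<^sup>2 < R\<^sup>2"
    using pos by (intro power_strict_mono) auto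
  \<comment> \<open>The removed interval must stay inside the square root piece, away from both
    \<open>a\<close> and \<open>a + R\<^sup>2\<close>.\<close>
  then have small: "\<forall>\<^sub>F e in at_right 0. e \<in> {0<..<min (t\<^sup>2) (R\<^sup>2 - t\<^sup>2)}"
    using pos by (intro eventually_at_right_real) auto
  \<comment> \<open>Regrouped so that the two values of the primitive next to the pole form a
    difference tending to 0.\<close>
  have "((\<lambda>e. K * (c + (?P (a + R\<^sup>2) - ?P a) + (?P (a + t\<^sup>2 - e) - ?P (a + t\<^sup>2 + e))))
      \<longlongrightarrow> K * (c + (?P (a + R\<^sup>2) - ?P a) + 0)) (at_right 0)"
    by (intro tendsto_intros sqrt_primitive_limit pos)
  moreover have "B = (\<lambda>e. K * (c + (?P (a + R\<^sup>2) - ?P a) + (?P (a + t\<^sup>2 - e) - ?P (a + t\<^sup>2 + e))))"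
    by (simp add: B_def algebra_simps)
  ultimately have "((\<lambda>e. ereal (1 / pi * B e)) \<longlongrightarrow> ereal (1 / pi * (K * (c + (?P (a + R\<^sup>2) - ?P a))))) (at_right 0)"
    by (intro tendsto_intros) simp_all
  then have "L \<le> ereal (1 / pi * (K * (c + (?P (a + R\<^sup>2) - ?P a))))"
  proof (rule tendsto_le[OF _ _ lim, rotated])
    show "\<forall>\<^sub>F e in at_right 0. ereal (1 / pi * (LINT y:{y. e < \<bar>a + t\<^sup>2 - y\<bar>}|lborel.
        half_laplacian_kernel f (a + t\<^sup>2) y)) \<le> ereal (1 / pi * B e)"
      using small
    proof eventually_elim
      case (elim e)
      have "(LINT y:{y. e < \<bar>a + t\<^sup>2 - y\<bar>}|lborel. half_laplacian_kernel f (a + t\<^sup>2) y) \<le> B e"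
        unfolding B_def c_def
        by (rule truncated_half_laplacian_le) (use elim pos in \<open>auto intro: int intro!: bounds bounds(2)[simplified]\<close>)
      then show ?case
        by (simp add: divide_right_mono)
    qed
  qed simp
  \<comment> \<open>The \<open>- 1 / t\<close> from the plateau cancels the \<open>1 / t\<close>
    from the square root piece.\<close>
  also have "c + (?P (a + R\<^sup>2) - ?P a) \<le> R / (a + t\<^sup>2 + a) - 1 / (R + t)"
    using sqrt_primitive_difference_le[OF pos(2,3), of a] by (simp add: c_def)
  moreover have "R / (a + t\<^sup>2 + a) \<le> R / (2 * a)"
    using pos by (intro frac_le) auto
  moreover have "1 / (2 * R) \<le> 1 / (R + t)"
    using pos by (intro frac_le) auto
  ultimately have "c + (?P (a + R\<^sup>2) - ?P a) \<le> R / (2 * a) - 1 / (2 * R)"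
    by linarith
  then have "1 / pi * (K * (c + (?P (a + R\<^sup>2) - ?P a))) \<le> 1 / pi * (K * (R / (2 * a) - 1 / (2 * R)))"
    using pos by (intro mult_left_mono) auto
  with \<open>L \<le> _\<close> show ?thesis
    by (meson ereal_less_eq(3) order_trans)
qed

section \<open>The touching argument and the contradiction\<close>

lemma even_decreasing_drop_le:
  fixes \<theta> :: "real \<Rightarrow> real"
  assumes even: "\<And>x. \<theta> (- x) = \<theta> x" and cont: "continuous_on UNIV \<theta>" and nonneg: "\<And>x. 0 \<le> \<theta> x"
    and decr: "\<And>x y. 0 \<le> x \<Longrightarrow> x \<le> y \<Longrightarrow> \<theta> y \<le> \<theta> x"
    and lap: "\<And>x. \<exists>L. has_half_laplacian \<theta> x L \<and> ereal (- A) \<le> L"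
    and "0 < a" "a < b" "\<theta> a \<le> M" "0 \<le> A" "A * a \<le> M"
  shows "\<theta> a - \<theta> b \<le> 4 * M / sqrt a * sqrt (b - a)"
proof (rule ccontr)
  \<comment> \<open>\<open>R\<close> is chosen so that the barrier reaches 0 at
    \<open>a + R\<^sup>2\<close>. The factor 4 gives \<open>K\<^sup>2 * a = 16 * M\<^sup>2\<close>,
    to be compared with \<open>9 * M\<^sup>2\<close> at the end.\<close>
  define K R where "K = 4 * M / sqrt a" and "R = \<theta> a / K"
  assume "\<not> \<theta> a - \<theta> b \<le> 4 * M / sqrt a * sqrt (b - a)"
  then have b: "\<theta> b + K * sqrt (b - a) < \<theta> a"
    by (simp add: K_def)
  have "0 \<le> M"
    using nonneg[of a] \<open>\<theta> a \<le> M\<close> by linarith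
  then have "0 \<le> K"
    using \<open>0 < a\<close> by (simp add: K_def)
  then have "0 \<le> K * sqrt (b - a)"
    using \<open>a < b\<close> by simp
  with b nonneg[of b] have "0 < \<theta> a" "K * sqrt (b - a) < \<theta> a"
    by linarith+
  with \<open>\<theta> a \<le> M\<close> have "0 < M"
    by linarith
  then have "0 < K"
    using \<open>0 < a\<close> by (simp add: K_def)
  have "0 < R" and KR: "K * R = \<theta> a"
    using \<open>0 < K\<close> \<open>0 < \<theta> a\<close> by (simp_all add: R_def)
  have "K * sqrt (b - a) < K * R"
    using \<open>K * sqrt (b - a) < \<theta> a\<close> KR by simp
  then have "sqrt (b - a) < R"
    using \<open>0 < K\<close> by simp
  then have "b - a < R\<^sup>2"
    using \<open>a < b\<close> power_strict_mono[of "sqrt (b - a)" R 2] by simp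
  \<comment> \<open>On this interval the function is \<open>\<theta> - \<phi>\<close> up to the
    constant \<open>\<theta> a\<close>.\<close>
  have "continuous_on {a..a + R\<^sup>2} (\<lambda>y. \<theta> y + K * sqrt (y - a))"
    by (intro continuous_intros continuous_on_subset[OF cont]) auto
  then obtain x0 where x0: "x0 \<in> {a..a + R\<^sup>2}"
    and min: "\<And>y. y \<in> {a..a + R\<^sup>2} \<Longrightarrow> \<theta> x0 + K * sqrt (x0 - a) \<le> \<theta> y + K * sqrt (y - a)"
    using continuous_attains_inf[of "{a..a + R\<^sup>2}" "\<lambda>y. \<theta> y + K * sqrt (y - a)"] by force
  \<comment> \<open>The point \<open>b\<close> makes the minimum of \<open>\<theta> - \<phi>\<close>
    negative. At \<open>a\<close> that difference vanishes and at \<open>a + R\<^sup>2\<close> it is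
    nonnegative, so \<open>x0\<close> is interior.\<close>
  have low: "\<theta> x0 + K * sqrt (x0 - a) < \<theta> a"
    using min[of b] b \<open>a < b\<close> \<open>b - a < R\<^sup>2\<close> by simp
  define t where "t = sqrt (x0 - a)"
  have x0_t: "x0 = a + t\<^sup>2"
    using x0 by (simp add: t_def)
  have "t \<noteq> 0"
  proof
    assume "t = 0"
    then have "x0 = a"
      using x0_t by simp
    with low show False
      by simp
  qed
  then have "0 < t"
    using x0 by (simp add: t_def order_less_le)
  have "K * t < K * R"
    using low KR nonneg[of x0] by (simp add: t_def)
  then have "t < R"
    using \<open>0 < K\<close> by simp
  obtain L where L: "has_half_laplacian \<theta> x0 L" "ereal (- A) \<le> L"
    using lap by blast
  note L(2)
  also have "L \<le> ereal (1 / pi * (K * (R / (2 * a) - 1 / (2 * R))))"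
  proof (rule half_laplacian_barrier_le[of _ t])
    show "has_half_laplacian \<theta> (a + t\<^sup>2) L"
      using L(1) by (simp add: x0_t)
  next
    fix y show "\<theta> (a + t\<^sup>2) - \<theta> y \<le> K * (R - t)"
      using low nonneg[of y] KR unfolding x0_t[symmetric] t_def[symmetric] right_diff_distrib by linarith
  next
    fix y assume "\<bar>y\<bar> \<le> a"
    then have "\<theta> a \<le> \<theta> \<bar>y\<bar>"
      by (intro decr) auto
    also have "\<theta> \<bar>y\<bar> = \<theta> y"
      by (auto simp: abs_if even)
    finally show "\<theta> (a + t\<^sup>2) - \<theta> y \<le> - K * t"
      using low unfolding x0_t[symmetric] t_def[symmetric] by simp
  next
    fix y assume "a \<le> y" "y \<le> a + R\<^sup>2"
    then show "\<theta> (a + t\<^sup>2) - \<theta> y \<le> K * (sqrt (y - a) - t)"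
      using min[of y] unfolding x0_t[symmetric] t_def[symmetric] right_diff_distrib by simp
  qed (use \<open>0 < a\<close> \<open>0 < t\<close> \<open>t < R\<close> \<open>0 < K\<close> in auto)
  finally have "- (pi * A) \<le> K * R / (2 * a) - K / (2 * R)"
    by (simp add: field_simps)
  also have "K / (2 * R) = K\<^sup>2 / (2 * \<theta> a)"
    using \<open>0 < K\<close> by (simp add: R_def power2_eq_square)
  also have "K\<^sup>2 = 16 * M\<^sup>2 / a"
    using \<open>0 < a\<close> by (simp add: K_def power_divide power_mult_distrib)
  finally have "- (pi * A) \<le> \<theta> a / (2 * a) - 16 * M\<^sup>2 / a / (2 * \<theta> a)"
    by (simp add: KR)
  \<comment> \<open>Multiplying by \<open>2 * a * \<theta> a\<close> clears all
    denominators.\<close>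
  then have "- (pi * A) * (2 * a * \<theta> a) \<le> (\<theta> a / (2 * a) - 16 * M\<^sup>2 / a / (2 * \<theta> a)) * (2 * a * \<theta> a)"
    using \<open>0 < a\<close> \<open>0 < \<theta> a\<close> by (intro mult_right_mono) auto
  also have "\<dots> = (\<theta> a)\<^sup>2 - 16 * M\<^sup>2"
    using \<open>0 < a\<close> \<open>0 < \<theta> a\<close> by (simp add: field_simps power2_eq_square)
  finally have "16 * M\<^sup>2 \<le> (\<theta> a)\<^sup>2 + 2 * pi * ((A * a) * \<theta> a)"
    by (simp add: algebra_simps)
  \<comment> \<open>Both \<open>\<theta> a\<close> and \<open>A * a\<close> are at most
    \<open>M\<close>, and \<open>pi < 4\<close>; the total \<open>9 * M\<^sup>2\<close> is less than
    \<open>16 * M\<^sup>2\<close>.\<close>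
  also have "\<dots> \<le> M\<^sup>2 + 2 * 4 * (M * M)"
    using assms(6-) \<open>0 < \<theta> a\<close> \<open>0 \<le> M\<close> pi_less_4
    by (intro add_mono power_mono mult_mono) auto
  finally show False
    using \<open>0 < M\<close> by (simp add: power2_eq_square)
qed

theorem theorem7p6:
  "\<exists>C::real. C > 0 \<and>
     (\<forall>(\<theta>::real \<Rightarrow> real) (A::real).
        (\<forall>x. \<theta> (- x) = \<theta> x) \<and>
        continuous_on UNIV \<theta> \<and>
        (\<forall>x. 0 \<le> \<theta> x) \<and>
        antimono_on {0..} \<theta> \<and>
        0 \<le> A \<and>
        (\<forall>x. \<exists>L. has_half_laplacian \<theta> x L \<and> ereal (- A) \<le> L) \<longrightarrow>
        (\<forall>x1 x2. 0 < x1 \<and> x1 < x2 \<longrightarrow>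
           \<theta> x1 - \<theta> x2 \<le> C * max (Linfty_norm \<theta>) (A * x1) * ((x2 - x1) / x1) powr (1 / 2)))"
proof (intro exI[of _ 4] conjI allI impI; (elim conjE)?)
  fix \<theta> :: "real \<Rightarrow> real" and A x1 x2 :: real
  assume even: "\<forall>x. \<theta> (- x) = \<theta> x" and cont: "continuous_on UNIV \<theta>" and nonneg: "\<forall>x. 0 \<le> \<theta> x"
    and anti: "antimono_on {0..} \<theta>" and "0 \<le> A"
    and lap: "\<forall>x. \<exists>L. has_half_laplacian \<theta> x L \<and> ereal (- A) \<le> L"
    and x: "0 < x1" "x1 < x2"
  have decr: "\<theta> y \<le> \<theta> x" if "0 \<le> x" "x \<le> y" for x y
    using anti that by (auto simp: monotone_on_def)
  have "\<theta> \<bar>x\<bar> = \<theta> x" for x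
    using even by (auto simp: abs_if)
  \<comment> \<open>This global bound supplies the \<open>B\<close> that keeps the essential
    supremum finite.\<close>
  then have "\<theta> x \<le> \<theta> 0" for x
    using decr[of 0 "\<bar>x\<bar>"] by simp
  then have "\<theta> x1 \<le> Linfty_norm \<theta>"
    using abs_le_Linfty_norm[OF cont, of "\<theta> 0" x1] nonneg by simp
  then have "\<theta> x1 - \<theta> x2 \<le> 4 * max (Linfty_norm \<theta>) (A * x1) / sqrt x1 * sqrt (x2 - x1)"
    using even cont nonneg lap x \<open>0 \<le> A\<close> by (intro even_decreasing_drop_le[where A = A] decr) auto
  then show "\<theta> x1 - \<theta> x2 \<le> 4 * max (Linfty_norm \<theta>) (A * x1) * ((x2 - x1) / x1) powr (1 / 2)"
    using x by (simp add: powr_half_sqrt real_sqrt_divide)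
qed simp

end
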